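(* Let $Y$ be a 0-dimensional Tychonoff space, let $\tau\geq\aleph_0$ be a cardinal, let $\pi_1:Y\times\mathbb N^\tau\to Y$ be the projection, and let $P$ and $K$ be compact subsets of $Y\times\mathbb N^\tau$. Then every homeomorphism $f:P\to K$ with $\pi_1\circ f=\pi_1|P$ can be extended to a homeomorphism $\widetilde f:Y\times\mathbb N^\tau\to Y\times\mathbb N^\tau$ such that $\pi_1\circ\widetilde f=\pi_1$.
   Context: $\mathbb N$ denotes the countable infinite discrete space and $\mathbb N^\tau$ its $\tau$-th power with the product topology. A 0-dimensional space means a Tychonoff space having a (Hausdorff) compactification of covering dimension $0$. *)

theory Defs
  imports "HOL-Analysis.Analysis" "HOL-Library.Extended_Nat"
begin

definition tychonoff_space :: "'a topology \<Rightarrow> bool" where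
  "tychonoff_space X \<longleftrightarrow> completely_regular_space X \<and> Hausdorff_space X"

definition open_cover :: "'a topology \<Rightarrow> 'a set set \<Rightarrow> bool" where
  "open_cover X \<U> \<longleftrightarrow> (\<forall>U\<in>\<U>. openin X U) \<and> \<Union>\<U> = topspace X"

definition refines :: "'a set set \<Rightarrow> 'a set set \<Rightarrow> bool" where
  "refines \<V> \<U> \<longleftrightarrow> (\<forall>V\<in>\<V>. \<exists>U\<in>\<U>. V \<subseteq> U)"

text \<open>The order of a family is the largest \<open>n\<close> such that some \<open>n + 1\<close> distinct members
  have a common point.\<close>

definition order_le :: "'a set set \<Rightarrow> nat \<Rightarrow> bool" where
  "order_le \<V> n \<longleftrightarrow> (\<forall>\<W>\<subseteq>\<V>. card \<W> = n + 2 \<longrightarrow> \<Inter>\<W> = {})"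

text \<open>Cech-Lebesgue dimension in terms of finite open covers, which is the usual definition
  for normal spaces; below it is only applied to compact Hausdorff spaces. The value is an
  extended natural number, so the empty space gets dimension 0 here instead of -1.\<close>

definition covering_dimension_le :: "'a topology \<Rightarrow> nat \<Rightarrow> bool" where
  "covering_dimension_le X n \<longleftrightarrow>
     (\<forall>\<U>. finite \<U> \<and> open_cover X \<U> \<longrightarrow>
        (\<exists>\<V>. finite \<V> \<and> open_cover X \<V> \<and> refines \<V> \<U> \<and> order_le \<V> n))"

definition covering_dimension :: "'a topology \<Rightarrow> enat" where
  "covering_dimension X = Inf {enat n | n. covering_dimension_le X n}"

definition compactification :: "'a topology \<Rightarrow> 'c topology \<Rightarrow> ('a \<Rightarrow> 'c) \<Rightarrow> bool" where
  "compactification X Z e \<longleftrightarrow>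
     compact_space Z \<and> Hausdorff_space Z \<and>
     embedding_map X Z e \<and> Z closure_of (e ` topspace X) = topspace Z"

text \<open>HOL cannot quantify existentially over the type carrying the compactification, so that
  type is a parameter. As a hypothesis, with the type a free variable of the theorem, this
  says that some compactification on some type has dimension 0.\<close>

definition zero_dimensional_space :: "'c itself \<Rightarrow> 'a topology \<Rightarrow> bool" where
  "zero_dimensional_space T X \<longleftrightarrow>
     tychonoff_space X \<and>
     (\<exists>(Z :: 'c topology) e. compactification X Z e \<and> covering_dimension Z = 0)"

text \<open>The power of the countable discrete space with exponent the cardinality of \<open>I\<close>.\<close>

definition nat_power :: "'i set \<Rightarrow> ('i \<Rightarrow> nat) topology" where
  "nat_power I = product_topology (\<lambda>_. discrete_topology (UNIV :: nat set)) I"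

end

theory Submission
  imports Defs
begin

text \<open>Write \<open>W\<close> for the power of the discrete space of natural numbers. The proof is Klee's trick for
  extending homeomorphisms between subsets of complementary factors, carried out over \<open>Y\<close>.

  Suppose first that \<open>P\<close> and \<open>K\<close> lie in the zero section \<open>(Y \<times> W) \<times> {0}\<close> of \<open>(Y \<times> W) \<times> W\<close>. Since
  \<open>f\<close> respects the projection to \<open>Y\<close>, it has the form \<open>((y, a), 0) \<mapsto> ((y, \<alpha> (y, a)), 0)\<close>, and its inverse
  is described in the same way by some \<open>\<beta>\<close>. Both \<open>\<alpha>\<close> and \<open>\<beta>\<close> are continuous maps from compact subsets
  of \<open>Y \<times> W\<close> to \<open>W\<close>. They extend continuously to all of \<open>Y \<times> W\<close>, because a map from a compact set to a
  discrete space takes finitely many values, on pieces that can be separated by clopen sets; this is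
  the point where the dimension of \<open>Y\<close> matters (\<open>continuous_extension_nat_power\<close>). As \<open>W\<close> is a
  topological group, the extensions give shears \<open>(x, b) \<mapsto> (x, b + \<alpha> x)\<close>, which are homeomorphisms over
  \<open>Y\<close>. A shear by \<open>\<alpha>\<close>, an exchange of the two factors \<open>W\<close> and a shear by \<open>\<beta>\<close> compose to an extension of
  \<open>f\<close> (\<open>extension_between_zero_sections\<close>).

  The general case reduces to this one. Each coordinate takes only finitely many values on a compact
  set, so \<open>P\<close> lies in the product of \<open>Y\<close> with a box of finite sets. The coordinates can be
  arranged in pairs because the index set is infinite. A bijection of \<open>nat \<times> nat\<close> can move any finite
  set into \<open>nat \<times> {0}\<close>, and such bijections, applied to all pairs, form a homeomorphism from \<open>Y \<times> W\<close>
  to \<open>(Y \<times> W) \<times> W\<close> that takes \<open>P\<close> into the zero section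
  (\<open>homeomorphism_moving_compact_to_zero_section\<close>). The same is done for \<open>K\<close>.\<close>

section \<open>Spaces with a base of clopen sets\<close>

definition has_clopen_base :: "'a topology \<Rightarrow> bool" where
  "has_clopen_base X \<longleftrightarrow>
     (\<forall>U x. openin X U \<and> x \<in> U \<longrightarrow> (\<exists>V. openin X V \<and> closedin X V \<and> x \<in> V \<and> V \<subseteq> U))"

lemma has_clopen_baseE:
  assumes "has_clopen_base X" "openin X U" "x \<in> U"
  obtains V where "openin X V" "closedin X V" "x \<in> V" "V \<subseteq> U"
  using assms unfolding has_clopen_base_def by blast

lemma has_clopen_base_embedding_map:
  assumes e: "embedding_map X Z e" and Z: "has_clopen_base Z"
  shows "has_clopen_base X"
  unfolding has_clopen_base_def
proof (intro allI impI)
  fix U x assume U: "openin X U \<and> x \<in> U"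
  then have Usub: "U \<subseteq> topspace X"
    using openin_subset by blast
  have hom: "homeomorphic_map X (subtopology Z (e ` topspace X)) e"
    using e by (simp add: embedding_map_def)
  have cont: "continuous_map X Z e"
    using hom homeomorphic_imp_continuous_map continuous_map_into_fulltopology by blast
  have inj: "inj_on e (topspace X)"
    using hom by (rule homeomorphic_imp_injective_map)
  have "openin (subtopology Z (e ` topspace X)) (e ` U)"
    using hom U Usub homeomorphic_map_openness_eq by blast
  then obtain T where T: "openin Z T" "e ` U = T \<inter> e ` topspace X"
    unfolding openin_subtopology by blast
  have "e x \<in> T"
    using T U by blast
  then obtain V where V: "openin Z V" "closedin Z V" "e x \<in> V" "V \<subseteq> T"
    using Z T has_clopen_baseE by metis
  let ?V = "{y \<in> topspace X. e y \<in> V}"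
  have "?V \<subseteq> U"
  proof
    fix y assume y: "y \<in> ?V"
    then have "e y \<in> e ` U"
      using T V by blast
    then show "y \<in> U"
      using inj y Usub by (auto dest: inj_onD)
  qed
  then show "\<exists>V. openin X V \<and> closedin X V \<and> x \<in> V \<and> V \<subseteq> U"
    using V U Usub cont
    by (intro exI[of _ ?V]) (auto intro: openin_continuous_map_preimage closedin_continuous_map_preimage)
qed

text \<open>Two distinct members of a family of order 0 are disjoint, so a cover of order 0 is a partition
  into open sets, which are therefore closed as well. Refining the cover by \<open>U\<close> and the complement
  of the point \<open>x\<close> puts \<open>x\<close> into a part contained in \<open>U\<close>.\<close>

lemma covering_dimension_0_imp_has_clopen_base:
  assumes dim: "covering_dimension Z = 0" and T1: "t1_space Z"
  shows "has_clopen_base Z"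
  unfolding has_clopen_base_def
proof (intro allI impI)
  fix U x assume U: "openin Z U \<and> x \<in> U"
  let ?D = "{enat n | n. covering_dimension_le Z n}"
  have Inf0: "Inf ?D = 0"
    using dim by (simp add: covering_dimension_def)
  then have "?D \<noteq> {}"
    by (auto simp: Inf_enat_def split: if_splits)
  then have "Inf ?D \<in> ?D"
    by (meson ex_in_conv wellorder_InfI)
  then have le: "covering_dimension_le Z 0"
    using Inf0 by (auto simp: zero_enat_def)
  have xZ: "x \<in> topspace Z"
    using U openin_subset by blast
  have "closedin Z {x}"
    using T1 xZ by (simp add: closedin_t1_singleton)
  then have "open_cover Z {U, topspace Z - {x}}"
    using U openin_subset[of Z U] by (auto simp: open_cover_def)
  then obtain \<V> where \<V>: "finite \<V>" "open_cover Z \<V>" "refines \<V> {U, topspace Z - {x}}" "order_le \<V> 0"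
    using le unfolding covering_dimension_le_def by (metis finite.emptyI finite.insertI)
  have disj: "A \<inter> B = {}" if "A \<in> \<V>" "B \<in> \<V>" "A \<noteq> B" for A B
  proof -
    have "\<Inter>{A, B} = {}"
      using \<V>(4) that unfolding order_le_def
      by (metis card_2_iff add_0 empty_subsetI insert_subset)
    then show ?thesis by simp
  qed
  obtain V where V: "V \<in> \<V>" "x \<in> V"
    using \<V>(2) xZ unfolding open_cover_def by blast
  have opens: "\<And>A. A \<in> \<V> \<Longrightarrow> openin Z A" and cover: "\<Union>\<V> = topspace Z"
    using \<V>(2) by (auto simp: open_cover_def)
  have "V = topspace Z - \<Union>(\<V> - {V})"
  proof
    show "V \<subseteq> topspace Z - \<Union>(\<V> - {V})"
      using cover V(1) disj[OF V(1)] by fastforce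
    show "topspace Z - \<Union>(\<V> - {V}) \<subseteq> V"
      unfolding cover[symmetric] by blast
  qed
  moreover have "openin Z (\<Union>(\<V> - {V}))"
    using opens by blast
  ultimately have "closedin Z V"
    by (metis closedin_diff closedin_topspace)
  moreover have "V \<subseteq> U"
    using \<V>(3) V unfolding refines_def by blast
  ultimately show "\<exists>V. openin Z V \<and> closedin Z V \<and> x \<in> V \<and> V \<subseteq> U"
    using V opens by blast
qed

lemma zero_dimensional_space_imp_has_clopen_base:
  assumes "zero_dimensional_space T X"
  shows "has_clopen_base X"
  using assms unfolding zero_dimensional_space_def compactification_def
  by (meson Hausdorff_imp_t1_space covering_dimension_0_imp_has_clopen_base
      has_clopen_base_embedding_map)

lemma has_clopen_base_prod_topology:
  assumes "has_clopen_base X" "has_clopen_base Y"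
  shows "has_clopen_base (prod_topology X Y)"
  unfolding has_clopen_base_def
proof (intro allI impI)
  fix W z assume W: "openin (prod_topology X Y) W \<and> z \<in> W"
  then obtain U V where UV: "openin X U" "openin Y V" "fst z \<in> U" "snd z \<in> V" "U \<times> V \<subseteq> W"
    unfolding openin_prod_topology_alt by (metis prod.collapse)
  obtain U' where U': "openin X U'" "closedin X U'" "fst z \<in> U'" "U' \<subseteq> U"
    using UV assms has_clopen_baseE by metis
  obtain V' where V': "openin Y V'" "closedin Y V'" "snd z \<in> V'" "V' \<subseteq> V"
    using UV assms has_clopen_baseE by metis
  show "\<exists>V. openin (prod_topology X Y) V \<and> closedin (prod_topology X Y) V \<and> z \<in> V \<and> V \<subseteq> W"
    using U' V' UV
    by (intro exI[of _ "U' \<times> V'"])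
      (auto simp: openin_prod_Times_iff closedin_prod_Times_iff mem_Times_iff)
qed

lemma topspace_nat_power [simp]: "topspace (nat_power I) = (\<Pi>\<^sub>E i\<in>I. UNIV)"
  by (simp add: nat_power_def)

lemma has_clopen_base_nat_power: "has_clopen_base (nat_power I)"
  unfolding has_clopen_base_def
proof (intro allI impI)
  fix W x assume W: "openin (nat_power I) W \<and> x \<in> W"
  then obtain U where U: "finite {i \<in> I. U i \<noteq> (UNIV::nat set)}" "x \<in> Pi\<^sub>E I U" "Pi\<^sub>E I U \<subseteq> W"
    unfolding nat_power_def openin_product_topology_alt by auto
  then show "\<exists>V. openin (nat_power I) V \<and> closedin (nat_power I) V \<and> x \<in> V \<and> V \<subseteq> W"
    unfolding nat_power_def
    by (intro exI[of _ "Pi\<^sub>E I U"]) (auto simp: openin_PiE_gen closedin_product_topology)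
qed

lemma Hausdorff_space_nat_power: "Hausdorff_space (nat_power I)"
  by (simp add: nat_power_def Hausdorff_space_product_topology)

lemma continuous_map_nat_power:
  "continuous_map X (nat_power I) f \<longleftrightarrow>
     f ` topspace X \<subseteq> extensional I \<and>
     (\<forall>i\<in>I. continuous_map X (discrete_topology UNIV) (\<lambda>x. f x i))"
  by (auto simp: nat_power_def continuous_map_componentwise)

lemma continuous_map_nat_power_component:
  assumes "continuous_map X (nat_power I) f" "i \<in> I"
  shows "continuous_map X (discrete_topology UNIV) (\<lambda>x. f x i)"
  using assms by (simp add: continuous_map_nat_power)

lemma continuous_map_discrete_compose2:
  assumes "continuous_map X (discrete_topology UNIV) f" "continuous_map X (discrete_topology UNIV) g"
  shows "continuous_map X (discrete_topology UNIV) (\<lambda>x. F (f x) (g x))"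
proof -
  have "continuous_map X (discrete_topology UNIV) (\<lambda>x. (f x, g x))"
    using assms continuous_map_paired[of X "discrete_topology UNIV" "discrete_topology UNIV" f g]
    by (simp flip: prod_topology_discrete_topology)
  then have "continuous_map X (discrete_topology UNIV) ((\<lambda>(a, b). F a b) \<circ> (\<lambda>x. (f x, g x)))"
    by (rule continuous_map_compose) simp
  then show ?thesis
    by (simp add: o_def)
qed

section \<open>Extending maps from compact sets\<close>

text \<open>By compactness finitely many clopen sets cover \<open>S\<close> such that \<open>g\<close> is constant on the trace of
  each. A finite family of clopen sets may be dealt with one member at a time: overwriting
  a continuous function by a constant on a clopen set keeps it continuous.\<close>

lemma continuous_extension_discrete:
  fixes g :: "'a \<Rightarrow> nat"
  assumes X: "has_clopen_base X" and S: "compactin X S"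
    and g: "continuous_map (subtopology X S) (discrete_topology UNIV) g"
  obtains h where "continuous_map X (discrete_topology UNIV) h" "\<And>x. x \<in> S \<Longrightarrow> h x = g x"
proof -
  define clopen_const where
    "clopen_const = {V. openin X V \<and> closedin X V \<and> (\<exists>c. \<forall>x\<in>S \<inter> V. g x = c)}"
  have "\<exists>V\<in>clopen_const. x \<in> V" if "x \<in> S" for x
  proof -
    have "x \<in> topspace X"
      using S that compactin_subset_topspace by blast
    moreover have "openin (subtopology X S) {y \<in> topspace (subtopology X S). g y \<in> {g x}}"
      using g by (rule openin_continuous_map_preimage) simp
    ultimately obtain T where T: "openin X T" "{y \<in> topspace X \<inter> S. g y = g x} = T \<inter> S"
      unfolding openin_subtopology by auto
    then have "x \<in> T"
      using \<open>x \<in> topspace X\<close> that by blast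
    then obtain V where V: "openin X V" "closedin X V" "x \<in> V" "V \<subseteq> T"
      using X T has_clopen_baseE by metis
    then have "\<forall>y\<in>S \<inter> V. g y = g x"
      using T by blast
    then show ?thesis
      using V by (auto simp: clopen_const_def)
  qed
  then have "S \<subseteq> \<Union>clopen_const" by blast
  moreover have "\<And>V. V \<in> clopen_const \<Longrightarrow> openin X V"
    by (simp add: clopen_const_def)
  ultimately obtain \<F> where \<F>: "finite \<F>" "\<F> \<subseteq> clopen_const" "S \<subseteq> \<Union>\<F>"
    using S unfolding compactin_def by meson
  have "\<exists>h. continuous_map X (discrete_topology UNIV) h \<and> (\<forall>x\<in>S \<inter> \<Union>\<F>. h x = g x)"
    using \<F>(1,2)
  proof (induction \<F>)
    case empty
    show ?case
      by (rule exI[of _ "\<lambda>_. 0"]) simp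
  next
    case (insert V \<F>)
    then obtain h where h: "continuous_map X (discrete_topology UNIV) h" "\<forall>x\<in>S \<inter> \<Union>\<F>. h x = g x"
      by auto
    obtain c where V: "openin X V" "closedin X V" and c: "\<forall>x\<in>S \<inter> V. g x = c"
      using insert.prems by (auto simp: clopen_const_def)
    have "continuous_map X (discrete_topology UNIV) (\<lambda>x. x \<in> V)"
      unfolding continuous_map_def
    proof (intro conjI allI impI)
      fix B :: "bool set"
      have "V \<subseteq> topspace X"
        using V openin_subset by blast
      moreover have "openin X (topspace X - V)"
        using V by blast
      moreover have "{x \<in> topspace X. (x \<in> V) \<in> B} =
          (if True \<in> B then V else {}) \<union> (if False \<in> B then topspace X - V else {})"
        using \<open>V \<subseteq> topspace X\<close> by (auto, (metis (full_types))+)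
      ultimately show "openin X {x \<in> topspace X. (x \<in> V) \<in> B}"
        using V by auto
    qed auto
    then have "continuous_map X (discrete_topology UNIV) (\<lambda>x. if x \<in> V then c else h x)"
      using h(1) by (rule continuous_map_discrete_compose2)
    then show ?case
      using h(2) c by (intro exI[of _ "\<lambda>x. if x \<in> V then c else h x"]) auto
  qed
  then show ?thesis
    using that \<F>(3) by blast
qed

lemma continuous_extension_nat_power:
  assumes X: "has_clopen_base X" and S: "compactin X S"
    and g: "continuous_map (subtopology X S) (nat_power I) g"
  obtains h where "continuous_map X (nat_power I) h" "\<And>x. x \<in> S \<Longrightarrow> h x = g x"
proof -
  have "\<exists>h. continuous_map X (discrete_topology UNIV) h \<and> (\<forall>x\<in>S. h x = g x i)" if "i \<in> I" for i
    using continuous_extension_discrete[OF X S continuous_map_nat_power_component[OF g that]]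
    by metis
  then obtain h where h: "\<And>i. i \<in> I \<Longrightarrow> continuous_map X (discrete_topology UNIV) (h i)"
    "\<And>i x. i \<in> I \<Longrightarrow> x \<in> S \<Longrightarrow> h i x = g x i"
    by metis
  show ?thesis
  proof
    show "continuous_map X (nat_power I) (\<lambda>x. \<lambda>i\<in>I. h i x)"
      using h(1) by (auto simp: continuous_map_nat_power)
    fix x assume x: "x \<in> S"
    then have "x \<in> topspace (subtopology X S)"
      using S compactin_subset_topspace by fastforce
    then have "g x \<in> extensional I"
      using g by (auto simp: continuous_map_nat_power)
    then show "(\<lambda>i\<in>I. h i x) = g x"
      using h(2) x by (auto simp: extensional_def)
  qed
qed

text \<open>An injective continuous map from a compact space to a Hausdorff space is an embedding, so the
  map to be extended can be transported to the compact image.\<close>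

lemma continuous_extension_along_injection:
  assumes X: "has_clopen_base X" "Hausdorff_space X" and Q: "compact_space Q"
    and u: "continuous_map Q X u" "inj_on u (topspace Q)"
    and v: "continuous_map Q (nat_power I) v"
  obtains h where "continuous_map X (nat_power I) h" "\<And>q. q \<in> topspace Q \<Longrightarrow> h (u q) = v q"
proof -
  let ?S = "u ` topspace Q"
  have S: "compactin X ?S"
    using image_compactin Q u(1) compact_space_def by blast
  have "embedding_map Q X u"
    using Q X(2) u continuous_imp_closed_map injective_closed_imp_embedding_map by blast
  then obtain w where w: "homeomorphic_maps Q (subtopology X ?S) u w"
    unfolding embedding_map_def homeomorphic_map_maps by blast
  then have "continuous_map (subtopology X ?S) (nat_power I) (v \<circ> w)"
    using v continuous_map_compose homeomorphic_maps_def by metis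
  then obtain h where h: "continuous_map X (nat_power I) h" "\<And>x. x \<in> ?S \<Longrightarrow> h x = (v \<circ> w) x"
    using continuous_extension_nat_power[OF X(1) S] by metis
  then show ?thesis
    using that w by (auto simp: homeomorphic_maps_def)
qed

section \<open>Klee's trick\<close>

definition zero_seq :: "'i set \<Rightarrow> 'i \<Rightarrow> nat" where
  "zero_seq I = (\<lambda>i\<in>I. 0)"

text \<open>Bitwise exclusive or makes the natural numbers a group in which every element is its own
  inverse; a shear with respect to this group structure is therefore an involution.\<close>

definition shear :: "'i set \<Rightarrow> ('b \<Rightarrow> 'i \<Rightarrow> nat) \<Rightarrow> 'b \<times> ('i \<Rightarrow> nat) \<Rightarrow> 'b \<times> ('i \<Rightarrow> nat)" where
  "shear I g = (\<lambda>(x, b). (x, \<lambda>i\<in>I. xor (b i) (g x i)))"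

lemma homeomorphic_map_shear:
  assumes g: "continuous_map X (nat_power I) g"
  shows "homeomorphic_map (prod_topology X (nat_power I)) (prod_topology X (nat_power I)) (shear I g)"
proof -
  let ?T = "prod_topology X (nat_power I)"
  have g_fst: "continuous_map ?T (nat_power I) (\<lambda>z. g (fst z))"
    using continuous_map_compose[OF continuous_map_fst g] by (simp add: o_def)
  have "continuous_map ?T (discrete_topology UNIV) (\<lambda>z. xor (snd z i) (g (fst z) i))" if "i \<in> I" for i
    by (rule continuous_map_discrete_compose2[OF
          continuous_map_nat_power_component[OF continuous_map_snd that]
          continuous_map_nat_power_component[OF g_fst that], where F = xor])
  then have "continuous_map ?T (nat_power I) (\<lambda>z. \<lambda>i\<in>I. xor (snd z i) (g (fst z) i))"
    by (auto simp: continuous_map_nat_power)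
  then have "continuous_map ?T ?T (\<lambda>z. (fst z, \<lambda>i\<in>I. xor (snd z i) (g (fst z) i)))"
    by (intro continuous_map_pairedI continuous_map_fst)
  then have cont: "continuous_map ?T ?T (shear I g)"
    by (simp add: shear_def case_prod_unfold)
  have "shear I g (shear I g z) = z" if "z \<in> topspace ?T" for z
  proof -
    have "snd z \<in> extensional I"
      using that by (auto simp: PiE_def)
    then have "(\<lambda>i\<in>I. xor ((\<lambda>i\<in>I. xor (snd z i) (g (fst z) i)) i) (g (fst z) i)) = snd z"
      by (auto simp: extensional_def xor.assoc)
    then show ?thesis
      by (simp add: shear_def case_prod_unfold)
  qed
  then have "homeomorphic_maps ?T ?T (shear I g) (shear I g)"
    using cont by (simp add: homeomorphic_maps_def)
  then show ?thesis
    using homeomorphic_map_maps by blast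
qed

lemma continuous_map_fst_fst_snd_fst:
  "continuous_map (prod_topology (prod_topology X Y) Z) X (\<lambda>z. fst (fst z))"
  "continuous_map (prod_topology (prod_topology X Y) Z) Y (\<lambda>z. snd (fst z))"
  using continuous_map_compose[OF continuous_map_fst continuous_map_fst]
    continuous_map_compose[OF continuous_map_fst continuous_map_snd]
  by (simp_all add: o_def)

definition swap_fibre :: "('a \<times> 'b) \<times> 'b \<Rightarrow> ('a \<times> 'b) \<times> 'b" where
  "swap_fibre = (\<lambda>((y, a), b). ((y, b), a))"

lemma homeomorphic_map_swap_fibre:
  "homeomorphic_map (prod_topology (prod_topology Y W) W) (prod_topology (prod_topology Y W) W)
     swap_fibre"
proof -
  let ?T = "prod_topology (prod_topology Y W) W"
  have "continuous_map ?T ?T (\<lambda>z. ((fst (fst z), snd z), snd (fst z)))"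
    by (intro continuous_map_pairedI continuous_map_fst_fst_snd_fst continuous_map_snd)
  then have "continuous_map ?T ?T swap_fibre"
    by (simp add: swap_fibre_def case_prod_unfold)
  then have "homeomorphic_maps ?T ?T swap_fibre swap_fibre"
    by (auto simp: homeomorphic_maps_def swap_fibre_def)
  then show ?thesis
    using homeomorphic_map_maps by blast
qed

text \<open>Write \<open>u q = (y, a)\<close> and \<open>v q = (y, b)\<close>. Choose \<open>\<alpha>\<close> and \<open>\<beta>\<close> with \<open>\<alpha> (y, a) = b\<close> and
  \<open>\<beta> (y, b) = a\<close> for all \<open>q\<close>. A shear by \<open>\<alpha>\<close> takes \<open>((y, a), 0)\<close> to \<open>((y, a), b)\<close>, the swap to
  \<open>((y, b), a)\<close>, and a shear by \<open>\<beta>\<close> to \<open>((y, b), 0)\<close>.\<close>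

lemma extension_between_zero_sections:
  assumes Y: "has_clopen_base Y" "Hausdorff_space Y" and Q: "compact_space Q"
    and u: "continuous_map Q (prod_topology Y (nat_power I)) u" "inj_on u (topspace Q)"
    and v: "continuous_map Q (prod_topology Y (nat_power I)) v" "inj_on v (topspace Q)"
    and fst_eq: "\<And>q. q \<in> topspace Q \<Longrightarrow> fst (u q) = fst (v q)"
  obtains h where
    "homeomorphic_map (prod_topology (prod_topology Y (nat_power I)) (nat_power I))
       (prod_topology (prod_topology Y (nat_power I)) (nat_power I)) h"
    "\<And>q. q \<in> topspace Q \<Longrightarrow> h (u q, zero_seq I) = (v q, zero_seq I)"
    "\<And>z. fst (fst (h z)) = fst (fst z)"
proof -
  let ?X = "prod_topology Y (nat_power I)"
  have X: "has_clopen_base ?X" "Hausdorff_space ?X"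
    using Y by (simp_all add: has_clopen_base_prod_topology has_clopen_base_nat_power
        Hausdorff_space_nat_power Hausdorff_space_prod_topology)
  have snds: "continuous_map Q (nat_power I) (\<lambda>q. snd (u q))"
    "continuous_map Q (nat_power I) (\<lambda>q. snd (v q))"
    using u(1) v(1) by (simp_all add: continuous_map_snd_of[unfolded o_def])
  obtain \<alpha> where \<alpha>: "continuous_map ?X (nat_power I) \<alpha>"
    "\<And>q. q \<in> topspace Q \<Longrightarrow> \<alpha> (u q) = snd (v q)"
    using continuous_extension_along_injection[OF X Q u snds(2)] by metis
  obtain \<beta> where \<beta>: "continuous_map ?X (nat_power I) \<beta>"
    "\<And>q. q \<in> topspace Q \<Longrightarrow> \<beta> (v q) = snd (u q)"
    using continuous_extension_along_injection[OF X Q v snds(1)] by metis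
  let ?h = "shear I \<beta> \<circ> swap_fibre \<circ> shear I \<alpha>"
  show ?thesis
  proof
    show "homeomorphic_map (prod_topology ?X (nat_power I)) (prod_topology ?X (nat_power I)) ?h"
      by (rule homeomorphic_map_compose[OF homeomorphic_map_shear[OF \<alpha>(1)]
            homeomorphic_map_compose[OF homeomorphic_map_swap_fibre homeomorphic_map_shear[OF \<beta>(1)]],
            unfolded comp_assoc[symmetric]])
    show "fst (fst (?h z)) = fst (fst z)" for z
      by (simp add: shear_def swap_fibre_def case_prod_unfold)
    fix q assume q: "q \<in> topspace Q"
    have "snd (v q) \<in> extensional I"
      using snds(2) q by (auto simp: continuous_map_nat_power)
    then have "(\<lambda>i\<in>I. xor (zero_seq I i) (snd (v q) i)) = snd (v q)"
      by (auto simp: zero_seq_def extensional_def)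
    then have "shear I \<alpha> (u q, zero_seq I) = (u q, snd (v q))"
      using \<alpha>(2)[OF q] by (simp add: shear_def)
    then have "swap_fibre (shear I \<alpha> (u q, zero_seq I)) = (v q, snd (u q))"
      using fst_eq[OF q] by (simp add: swap_fibre_def case_prod_unfold)
    then show "?h (u q, zero_seq I) = (v q, zero_seq I)"
      using \<beta>(2)[OF q] by (simp add: shear_def zero_seq_def cong: restrict_cong)
  qed
qed

section \<open>Moving a compact set into half of the coordinates\<close>

text \<open>Under \<open>prod_encode\<close> the set \<open>S\<close> becomes a subset of some \<open>{..<M}\<close>. Cutting the natural numbers into
  intervals of length \<open>M\<close> and tiling the rows of the plane with them gives a bijection back to the
  plane; it takes \<open>{..<M}\<close> to the beginning of row 0 because \<open>prod_decode 0 = (0, 0)\<close>.\<close>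

lemma finite_plane_set_to_axis:
  fixes S :: "(nat \<times> nat) set"
  assumes "finite S"
  shows "\<exists>\<psi> :: nat \<times> nat \<Rightarrow> nat \<times> nat. bij \<psi> \<and> (\<forall>z\<in>S. snd (\<psi> z) = 0)"
proof -
  have "finite (prod_encode ` S)"
    using assms by simp
  then obtain m where m: "\<And>z. z \<in> S \<Longrightarrow> prod_encode z < m"
    unfolding finite_nat_iff_bounded by blast
  \<comment> \<open>For empty \<open>S\<close> the bound \<open>m\<close> may be 0, but the length of the intervals must be positive.\<close>
  define M where "M = Suc m"
  let ?\<chi> = "\<lambda>n. (fst (prod_decode (n div M)) * M + n mod M, snd (prod_decode (n div M)))"
  let ?\<theta> = "\<lambda>(a, d). prod_encode (a div M, d) * M + a mod M"
  have M: "0 < M"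
    by (simp add: M_def)
  have "bij ?\<chi>"
  proof (rule o_bij[where g = ?\<theta>])
    show "?\<theta> \<circ> ?\<chi> = id"
      using M by (auto simp: fun_eq_iff)
    show "?\<chi> \<circ> ?\<theta> = id"
      using M by (auto simp: fun_eq_iff)
  qed
  then have "bij (?\<chi> \<circ> prod_encode)"
    using bij_prod_encode bij_comp by blast
  moreover have "snd ((?\<chi> \<circ> prod_encode) z) = 0" if "z \<in> S" for z
    using m[OF that] by (simp add: M_def prod_decode_def prod_decode_aux.simps)
  ultimately show ?thesis
    by blast
qed

lemma infinite_split_in_two:
  assumes "infinite I"
  obtains \<iota> \<kappa> where "bij_betw (case_sum \<iota> \<kappa>) (I <+> I) I"
proof -
  have "(card_of (I <+> I), card_of I) \<in> ordIso"
    using card_of_Plus_infinite1[OF assms] card_of_refl ordIso_imp_ordLeq by blast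
  then obtain h where "bij_betw h (I <+> I) I"
    using card_of_ordIso by blast
  moreover have "case_sum (h \<circ> Inl) (h \<circ> Inr) = h"
    by (auto simp: fun_eq_iff split: sum.split)
  ultimately show ?thesis
    using that by metis
qed

text \<open>The coordinates are paired, and on each pair a bijection of \<open>nat \<times> nat\<close> moves the finite set
  \<open>F (\<iota> j) \<times> F (\<kappa> j)\<close> into the first axis. Any choice of bijections is continuous in both
  directions, since every new coordinate is a function of two old ones, which are discrete.\<close>

lemma homeomorphism_moving_box_to_zero_section:
  fixes F :: "'i \<Rightarrow> nat set"
  assumes I: "infinite I" and F: "\<And>i. i \<in> I \<Longrightarrow> finite (F i)"
  obtains \<gamma> where
    "homeomorphic_map (nat_power I) (prod_topology (nat_power I) (nat_power I)) \<gamma>"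
    "\<And>s. s \<in> Pi\<^sub>E I F \<Longrightarrow> snd (\<gamma> s) = zero_seq I"
proof -
  obtain \<iota> \<kappa> :: "'i \<Rightarrow> 'i" where bij: "bij_betw (case_sum \<iota> \<kappa>) (I <+> I) I"
    using infinite_split_in_two[OF I] by metis
  have \<iota>: "\<iota> j \<in> I" and \<kappa>: "\<kappa> j \<in> I" if "j \<in> I" for j
    using bij_betw_apply[OF bij, of "Inl j"] bij_betw_apply[OF bij, of "Inr j"] that by auto
  \<comment> \<open>For the inverse of \<open>\<gamma>\<close>, \<open>\<rho> i\<close> tells to which pair \<open>i\<close> belongs and in which place.\<close>
  define \<rho> where "\<rho> = inv_into (I <+> I) (case_sum \<iota> \<kappa>)"
  have \<rho>_\<iota>: "\<rho> (\<iota> j) = Inl j" and \<rho>_\<kappa>: "\<rho> (\<kappa> j) = Inr j" if "j \<in> I" for j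
    using inv_into_f_f[OF bij_betw_imp_inj_on[OF bij], of "Inl j"]
      inv_into_f_f[OF bij_betw_imp_inj_on[OF bij], of "Inr j"] that
    by (auto simp: \<rho>_def)
  have cover: "(\<exists>j\<in>I. i = \<iota> j) \<or> (\<exists>j\<in>I. i = \<kappa> j)" if "i \<in> I" for i
  proof -
    have "i \<in> case_sum \<iota> \<kappa> ` (I <+> I)"
      using that by (simp only: bij_betw_imp_surj_on[OF bij])
    then obtain x where "i = case_sum \<iota> \<kappa> x" "x \<in> I <+> I"
      by (rule imageE)
    then show ?thesis
      by auto
  qed
  have "\<exists>\<psi> :: nat \<times> nat \<Rightarrow> nat \<times> nat. bij \<psi> \<and> (\<forall>z\<in>F (\<iota> j) \<times> F (\<kappa> j). snd (\<psi> z) = 0)"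
    if "j \<in> I" for j
    by (rule finite_plane_set_to_axis) (simp add: F \<iota> \<kappa> that)
  then obtain \<psi> :: "'i \<Rightarrow> nat \<times> nat \<Rightarrow> nat \<times> nat" where \<psi>: "\<And>j. j \<in> I \<Longrightarrow> bij (\<psi> j)"
    "\<And>j z. j \<in> I \<Longrightarrow> z \<in> F (\<iota> j) \<times> F (\<kappa> j) \<Longrightarrow> snd (\<psi> j z) = 0"
    by metis
  define \<gamma> where "\<gamma> s = (\<lambda>j\<in>I. fst (\<psi> j (s (\<iota> j), s (\<kappa> j))), \<lambda>j\<in>I. snd (\<psi> j (s (\<iota> j), s (\<kappa> j))))" for s
  define \<delta> where "\<delta> = (\<lambda>(a, b). \<lambda>i\<in>I. case \<rho> i of
      Inl j \<Rightarrow> fst (inv (\<psi> j) (a j, b j)) | Inr j \<Rightarrow> snd (inv (\<psi> j) (a j, b j)))"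
  let ?W = "nat_power I"
  have coord: "continuous_map ?W (discrete_topology UNIV) (\<lambda>s. s i)" if "i \<in> I" for i
    using continuous_map_nat_power_component[of ?W I id] that by simp
  have "continuous_map ?W (discrete_topology UNIV) (\<lambda>s. fst (\<psi> j (s (\<iota> j), s (\<kappa> j))))"
    "continuous_map ?W (discrete_topology UNIV) (\<lambda>s. snd (\<psi> j (s (\<iota> j), s (\<kappa> j))))" if "j \<in> I" for j
    using continuous_map_discrete_compose2[OF coord[OF \<iota>[OF that]] coord[OF \<kappa>[OF that]],
        where F = "\<lambda>a b. fst (\<psi> j (a, b))"]
      continuous_map_discrete_compose2[OF coord[OF \<iota>[OF that]] coord[OF \<kappa>[OF that]],
        where F = "\<lambda>a b. snd (\<psi> j (a, b))"]
    by simp_all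
  then have cont_\<gamma>: "continuous_map ?W (prod_topology ?W ?W) \<gamma>"
    unfolding \<gamma>_def by (intro continuous_map_pairedI) (auto simp: continuous_map_nat_power)
  have coord2: "continuous_map (prod_topology ?W ?W) (discrete_topology UNIV) (\<lambda>z. fst z i)"
    "continuous_map (prod_topology ?W ?W) (discrete_topology UNIV) (\<lambda>z. snd z i)" if "i \<in> I" for i
    using continuous_map_nat_power_component that continuous_map_fst continuous_map_snd by metis+
  have "continuous_map (prod_topology ?W ?W) (discrete_topology UNIV) (\<lambda>z. \<delta> z i)" if "i \<in> I" for i
    using cover[OF that]
  proof (elim disjE bexE)
    fix j assume j: "j \<in> I" "i = \<iota> j"
    show ?thesis
      using continuous_map_discrete_compose2[OF coord2[OF j(1)],
          where F = "\<lambda>a b. fst (inv (\<psi> j) (a, b))"] j \<open>i \<in> I\<close>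
      by (simp add: \<delta>_def case_prod_unfold \<rho>_\<iota>)
  next
    fix j assume j: "j \<in> I" "i = \<kappa> j"
    show ?thesis
      using continuous_map_discrete_compose2[OF coord2[OF j(1)],
          where F = "\<lambda>a b. snd (inv (\<psi> j) (a, b))"] j \<open>i \<in> I\<close>
      by (simp add: \<delta>_def case_prod_unfold \<rho>_\<kappa>)
  qed
  then have cont_\<delta>: "continuous_map (prod_topology ?W ?W) ?W \<delta>"
    by (auto simp: continuous_map_nat_power \<delta>_def)
  have "\<delta> (\<gamma> s) = s" if "s \<in> topspace ?W" for s
  proof
    fix i
    show "\<delta> (\<gamma> s) i = s i"
    proof (cases "i \<in> I")
      case True
      then show ?thesis
        using cover[OF True] \<psi>(1)
        by (auto simp: \<gamma>_def \<delta>_def \<rho>_\<iota> \<rho>_\<kappa> bij_is_inj inv_f_f)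
    next
      case False
      then show ?thesis
        using that by (auto simp: \<gamma>_def \<delta>_def PiE_def extensional_def)
    qed
  qed
  moreover have "\<gamma> (\<delta> z) = z" if "z \<in> topspace (prod_topology ?W ?W)" for z
  proof -
    have ext: "fst z \<in> extensional I" "snd z \<in> extensional I"
      using that by (auto simp: PiE_def)
    have "\<psi> j (\<delta> z (\<iota> j), \<delta> z (\<kappa> j)) = (fst z j, snd z j)" if "j \<in> I" for j
      using that \<psi>(1)[OF that] \<iota> \<kappa>
      by (simp add: \<delta>_def case_prod_unfold \<rho>_\<iota> \<rho>_\<kappa> bij_is_surj surj_f_inv_f)
    then show ?thesis
      using ext by (auto simp: \<gamma>_def prod_eq_iff extensional_def fun_eq_iff)
  qed
  ultimately have "homeomorphic_maps ?W (prod_topology ?W ?W) \<gamma> \<delta>"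
    using cont_\<gamma> cont_\<delta> by (simp add: homeomorphic_maps_def)
  then have "homeomorphic_map ?W (prod_topology ?W ?W) \<gamma>"
    using homeomorphic_map_maps by blast
  moreover have "snd (\<gamma> s) = zero_seq I" if "s \<in> Pi\<^sub>E I F" for s
    using that \<psi>(2) \<iota> \<kappa> by (auto simp: \<gamma>_def zero_seq_def fun_eq_iff PiE_def Pi_def)
  ultimately show ?thesis
    using that by blast
qed

text \<open>A compact set has finite image under each coordinate map, because compact sets of natural
  numbers are finite. So it lies in a product of finite sets.\<close>

lemma homeomorphism_moving_compact_to_zero_section:
  assumes I: "infinite I" and P: "compactin (prod_topology Y (nat_power I)) P"
  obtains \<Phi> where
    "homeomorphic_map (prod_topology Y (nat_power I))
       (prod_topology (prod_topology Y (nat_power I)) (nat_power I)) \<Phi>"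
    "\<And>p. p \<in> P \<Longrightarrow> snd (\<Phi> p) = zero_seq I"
    "\<And>p. fst (fst (\<Phi> p)) = fst p"
proof -
  let ?W = "nat_power I"
  let ?F = "\<lambda>i. (\<lambda>p. snd p i) ` P"
  have "finite (?F i)" if "i \<in> I" for i
  proof -
    have "continuous_map (prod_topology Y ?W) (discrete_topology UNIV) (\<lambda>p. snd p i)"
      using continuous_map_nat_power_component[OF continuous_map_snd that] .
    then have "compactin (discrete_topology UNIV) (?F i)"
      using P image_compactin by blast
    then show ?thesis
      by (simp add: compactin_discrete_topology)
  qed
  then obtain \<gamma> where \<gamma>: "homeomorphic_map ?W (prod_topology ?W ?W) \<gamma>"
    "\<And>s. s \<in> Pi\<^sub>E I ?F \<Longrightarrow> snd (\<gamma> s) = zero_seq I"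
    using homeomorphism_moving_box_to_zero_section[OF I, of ?F] by metis
  then obtain \<delta> where \<delta>: "homeomorphic_maps ?W (prod_topology ?W ?W) \<gamma> \<delta>"
    using homeomorphic_map_maps by blast
  let ?\<Phi> = "\<lambda>p. ((fst p, fst (\<gamma> (snd p))), snd (\<gamma> (snd p)))"
  let ?\<Psi> = "\<lambda>z. (fst (fst z), \<delta> (snd (fst z), snd z))"
  let ?T = "prod_topology Y ?W" and ?T' = "prod_topology (prod_topology Y ?W) ?W"
  have "continuous_map ?T (prod_topology ?W ?W) (\<lambda>p. \<gamma> (snd p))"
    using \<delta> continuous_map_compose[OF continuous_map_snd, of ?W "prod_topology ?W ?W" \<gamma> Y]
    by (simp add: homeomorphic_maps_def o_def)
  then have "continuous_map ?T ?T' ?\<Phi>"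
    by (intro continuous_map_pairedI continuous_map_fst continuous_map_fst_of[unfolded o_def]
        continuous_map_snd_of[unfolded o_def])
  moreover have "continuous_map ?T' (prod_topology ?W ?W) (\<lambda>z. (snd (fst z), snd z))"
    by (intro continuous_map_pairedI continuous_map_fst_fst_snd_fst continuous_map_snd)
  then have "continuous_map ?T' ?W (\<lambda>z. \<delta> (snd (fst z), snd z))"
    using \<delta> continuous_map_compose[of ?T' "prod_topology ?W ?W" "\<lambda>z. (snd (fst z), snd z)" ?W \<delta>]
    by (simp add: homeomorphic_maps_def o_def)
  then have "continuous_map ?T' ?T ?\<Psi>"
    by (intro continuous_map_pairedI continuous_map_fst_fst_snd_fst)
  ultimately have "homeomorphic_maps ?T ?T' ?\<Phi> ?\<Psi>"
    using \<delta> by (auto simp: homeomorphic_maps_def)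
  then have "homeomorphic_map ?T ?T' ?\<Phi>"
    using homeomorphic_map_maps by blast
  moreover have "snd (?\<Phi> p) = zero_seq I" if "p \<in> P" for p
  proof -
    have "snd p \<in> Pi\<^sub>E I ?F"
      using compactin_subset_topspace[OF P] that by (auto simp: PiE_def Pi_def)
    then show ?thesis
      using \<gamma>(2) by simp
  qed
  ultimately show ?thesis
    using that[of ?\<Phi>] by simp
qed

section \<open>The extension theorem\<close>

theorem theorem1p1:
  fixes Y :: "'a topology" and I :: "'i set"
    and P K :: "('a \<times> ('i \<Rightarrow> nat)) set"
    and f :: "'a \<times> ('i \<Rightarrow> nat) \<Rightarrow> 'a \<times> ('i \<Rightarrow> nat)"
  assumes "zero_dimensional_space TYPE('c) Y"
    and "infinite I"
    and "compactin (prod_topology Y (nat_power I)) P"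
    and "compactin (prod_topology Y (nat_power I)) K"
    and "homeomorphic_map (subtopology (prod_topology Y (nat_power I)) P)
           (subtopology (prod_topology Y (nat_power I)) K) f"
    and "\<forall>p\<in>P. fst (f p) = fst p"
  shows "\<exists>g. homeomorphic_map (prod_topology Y (nat_power I)) (prod_topology Y (nat_power I)) g \<and>
           (\<forall>p\<in>P. g p = f p) \<and>
           (\<forall>x\<in>topspace (prod_topology Y (nat_power I)). fst (g x) = fst x)"
proof -
  let ?W = "nat_power I"
  let ?T = "prod_topology Y ?W" and ?T' = "prod_topology (prod_topology Y ?W) ?W"
  let ?Q = "subtopology ?T P"
  have Y: "has_clopen_base Y" "Hausdorff_space Y"
    using assms(1) zero_dimensional_space_imp_has_clopen_base
    by (auto simp: zero_dimensional_space_def tychonoff_space_def)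
  have PT: "P \<subseteq> topspace ?T" and KT: "K \<subseteq> topspace ?T"
    using assms(3,4) compactin_subset_topspace by blast+
  have Q: "topspace ?Q = P" "compact_space ?Q"
    using PT assms(3) by (auto simp: compact_space_subtopology)
  obtain \<Phi> where \<Phi>: "homeomorphic_map ?T ?T' \<Phi>" "\<And>p. p \<in> P \<Longrightarrow> snd (\<Phi> p) = zero_seq I"
    "\<And>p. fst (fst (\<Phi> p)) = fst p"
    using homeomorphism_moving_compact_to_zero_section[OF assms(2,3)] by metis
  obtain \<Psi> where \<Psi>: "homeomorphic_map ?T ?T' \<Psi>" "\<And>p. p \<in> K \<Longrightarrow> snd (\<Psi> p) = zero_seq I"
    "\<And>p. fst (fst (\<Psi> p)) = fst p"
    using homeomorphism_moving_compact_to_zero_section[OF assms(2,4)] by metis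
  obtain \<Theta> where \<Theta>: "homeomorphic_maps ?T ?T' \<Psi> \<Theta>"
    using \<Psi>(1) homeomorphic_map_maps by blast
  have fK: "f p \<in> K" if "p \<in> P" for p
    using homeomorphic_imp_surjective_map[OF assms(5)] that PT by auto
  have f_cont: "continuous_map ?Q ?T f"
    using assms(5) homeomorphic_imp_continuous_map continuous_map_into_fulltopology by blast
  have f_inj: "inj_on f P"
    using homeomorphic_imp_injective_map[OF assms(5)] Q(1) by simp
  let ?u = "\<lambda>p. fst (\<Phi> p)" and ?v = "\<lambda>p. fst (\<Psi> (f p))"
  have "continuous_map ?T ?T' \<Phi>" "continuous_map ?T ?T' \<Psi>"
    using \<Phi>(1) \<Psi>(1) homeomorphic_imp_continuous_map by blast+
  then have "continuous_map ?Q ?T' \<Phi>" "continuous_map ?Q ?T' (\<Psi> \<circ> f)"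
    using f_cont continuous_map_compose continuous_map_from_subtopology by blast+
  then have uv_cont: "continuous_map ?Q ?T ?u" "continuous_map ?Q ?T ?v"
    by (auto dest: continuous_map_fst_of simp: o_def)
  have "inj_on \<Phi> (topspace ?T)" "inj_on \<Psi> (topspace ?T)"
    using \<Phi>(1) \<Psi>(1) homeomorphic_imp_injective_map by blast+
  then have uv_inj: "inj_on ?u (topspace ?Q)" "inj_on ?v (topspace ?Q)"
    using PT KT fK f_inj \<Phi>(2) \<Psi>(2) unfolding Q(1) inj_on_def
    by (metis prod.expand subsetD)+
  have "fst (?u p) = fst (?v p)" if "p \<in> topspace ?Q" for p
    using that assms(6) \<Phi>(3) \<Psi>(3) Q(1) by simp
  then obtain h where h: "homeomorphic_map ?T' ?T' h"
    "\<And>p. p \<in> P \<Longrightarrow> h (?u p, zero_seq I) = (?v p, zero_seq I)"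
    "\<And>z. fst (fst (h z)) = fst (fst z)"
    using extension_between_zero_sections[OF Y Q(2) uv_cont(1) uv_inj(1) uv_cont(2) uv_inj(2)]
    unfolding Q(1) by metis
  \<comment> \<open>Conjugate back; \<open>\<Theta>\<close> undoes \<open>\<Psi>\<close>, the homeomorphism that straightens \<open>K\<close>.\<close>
  let ?g = "\<Theta> \<circ> h \<circ> \<Phi>"
  have "homeomorphic_map ?T' ?T \<Theta>"
    using \<Theta> homeomorphic_map_maps homeomorphic_maps_sym by blast
  then have "homeomorphic_map ?T ?T ?g"
    by (rule homeomorphic_map_compose[OF \<Phi>(1) homeomorphic_map_compose[OF h(1)]])
  moreover have "?g p = f p" if "p \<in> P" for p
  proof -
    have "h (\<Phi> p) = \<Psi> (f p)"
      using h(2)[OF that] \<Phi>(2)[OF that] \<Psi>(2)[OF fK[OF that]] by (metis prod.collapse)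
    then show ?thesis
      using \<Theta> fK[OF that] KT by (auto simp: homeomorphic_maps_def)
  qed
  moreover have "fst (?g x) = fst x" if "x \<in> topspace ?T" for x
  proof -
    have "h (\<Phi> x) \<in> topspace ?T'"
      using that homeomorphic_imp_surjective_map[OF \<Phi>(1)] homeomorphic_imp_surjective_map[OF h(1)]
      by blast
    then have "\<Psi> (?g x) = h (\<Phi> x)"
      using \<Theta> unfolding homeomorphic_maps_def comp_def by blast
    then show ?thesis
      using \<Psi>(3) \<Phi>(3) h(3) by metis
  qed
  ultimately show ?thesis by blast
qed

end
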